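(* Let $H$ be an invertible Hermitian matrix and let $B_0$ be a nilpotent $H$-nonnegative matrix in Jordan form, with the pair $(B_0,H)$ in canonical form, $$B_0=\bigoplus_{i=1}^sJ_1(0)\oplus\bigoplus_{i=1}^tJ_2(0),\qquad H=\bigoplus_{i=1}^s\varepsilon_iQ_1\oplus\bigoplus_{i=1}^tQ_2,\qquad \varepsilon_i=\pm1.$$ Suppose that the number of Jordan blocks of size one of $B_0$ with positive sign characteristic is not less than the number of Jordan blocks of size two, i.e. $s_+\ge t$, where $s_+$ is the number of $i$ with $\varepsilon_i=1$, and suppose that $B_0$ has a Segre pairing $\mathcal{S}$. Then any pair of $\mathcal{S}$ is of the form $(2,1)$, $(1,1)$ or $(1,0)$. This corresponds to Jordan blocks of the form $J_2(0)\oplus J_1(0)$, $J_1(0)\oplus J_1(0)$ and $J_1(0)$, respectively, in the matrix $B_0$. The $H$-selfadjoint square roots associated with each possible pair in $\mathcal{S}$ are as follows. (i) The $H$-selfadjoint square root of $J_1(0)=[0]$, which is associated with the pair $(1,0)$, is equal to $[0]$. Its Jordan form is $J_1(0)$ again. (ii) The $H$-selfadjoint square root of $J_1(0)\oplus J_1(0)$, which is associated with the pair $(1,1)$, and where the two blocks have opposite sign characteristic, is $$\begin{bmatrix}\alpha&-\bar\beta\\ \beta&-\alpha\end{bmatrix},\quad\text{for any real }\alpha\neq 0\text{ and complex }\beta,\ |\beta|=\pm\alpha.$$ The Jordan form of all matrices of this form is $J_2(0)$. (iii) The $H$-selfadjoint square root of $J_2(0)\oplus J_1(0)$, which is associated with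 the pair $(2,1)$, and where the two blocks both have positive sign characteristic, is $$\begin{bmatrix}0&\alpha&\beta\\0&0&0\\0&\frac1\beta&0\end{bmatrix},\quad\text{for real }\alpha\text{ and complex }\beta,\ |\beta|=1.$$ The Jordan form of all matrices of this form is $J_3(0)$.
   Context: With $(\cdot,\cdot)$ the Euclidean inner product on $\mathbb{C}^n$ and $[x,y]=(Hx,y)$: a matrix $B$ is $H$-nonnegative if $[Bx,x]\ge 0$ for all $x\in\mathbb{C}^n$, and $A$ is $H$-selfadjoint if $HA=A^*H$. A square root of $B$ is a complex matrix $A$ with $A^2=B$. $J_k(\lambda)$ is the $k\times k$ Jordan block with eigenvalue $\lambda$; $Q_k$ is the $k\times k$ matrix with ones on the main anti-diagonal and zeros elsewhere. A block $J_k(0)$ of $B_0$ whose corresponding block of $H$ is $\varepsilon Q_k$ has positive (negative) sign characteristic if $\varepsilon=1$ ($\varepsilon=-1$). The Segre characteristic of $B_0$ is the list $(n_1,\ldots,n_r)$ of the sizes of its Jordan blocks in decreasing order. A Segre pairing of $B_0$ is a collection (repetitions allowed, arranged lexicographically) of pairs of numbers from $\{n_1,\ldots,n_r\}\cup\{0\}$ such that: each entry of the Segre characteristic (counted with multiplicity) appears in one and only one pair; each pair consists of two entries of the Segre characteristic or of one entry and one zero, with first entry greater than or equal to the second; and the absolute difference between the two entries of each pair is at most one. The square roots associated with a pair $(m,n)$ are the square roots of the corresponding $J_m(0)\oplus J_n(0)$ (of $J_1(0)$ for the pair $(1,0)$), except that by convention the $2\times2$ zero matrix is not admitted as a square root associated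 with the pair $(1,1)$ (it is covered by two pairs $(1,0),(1,0)$). For the square roots associated with a single pair, "$H$-selfadjoint" refers to the diagonal block of $H$ corresponding to the Jordan blocks of that pair.
   Formalization: As stated, a Segre pairing may contain (2,2) (e.g. s=t=2, both signs +, S={(2,2),(1,1)}); the formal theorem allows (2,2) as the only exception to the listed forms and proves that such a pair has no H-selfadjoint square root. *)

theory Defs
  imports
    "Jordan_Normal_Form.Jordan_Normal_Form"
    "Jordan_Normal_Form.Jordan_Normal_Form_Uniqueness"
    "Jordan_Normal_Form.Schur_Decomposition"
    "HOL-Library.Multiset"
begin

section \<open>Indefinite inner products\<close>

definition hermitian_mat :: "complex mat \<Rightarrow> bool" where
  "hermitian_mat H \<longleftrightarrow> mat_adjoint H = H"

text \<open>The library scalar product with \<open>\<bullet>c\<close> is linear in its first argument and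
  conjugate-linear in the second.\<close>

definition hprod :: "complex mat \<Rightarrow> complex vec \<Rightarrow> complex vec \<Rightarrow> complex" where
  "hprod H x y = (H *\<^sub>v x) \<bullet>c y"

text \<open>On complex numbers \<open>0 \<le> z\<close> means that \<open>z\<close> is real and nonnegative.\<close>

definition h_nonnegative :: "complex mat \<Rightarrow> complex mat \<Rightarrow> bool" where
  "h_nonnegative H B \<longleftrightarrow> (\<forall>x\<in>carrier_vec (dim_row H). 0 \<le> hprod H (B *\<^sub>v x) x)"

definition h_selfadjoint :: "complex mat \<Rightarrow> complex mat \<Rightarrow> bool" where
  "h_selfadjoint H A \<longleftrightarrow> H * A = mat_adjoint A * H"

definition nilpotent_mat :: "complex mat \<Rightarrow> bool" where
  "nilpotent_mat B \<longleftrightarrow> (\<exists>k. B ^\<^sub>m k = 0\<^sub>m (dim_row B) (dim_row B))"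

definition sqrt_mat :: "complex mat \<Rightarrow> complex mat \<Rightarrow> bool" where
  "sqrt_mat B A \<longleftrightarrow> A \<in> carrier_mat (dim_row B) (dim_row B) \<and> A * A = B"


section \<open>Canonical forms of nilpotent matrices\<close>

definition sip_mat :: "nat \<Rightarrow> complex mat" where
  "sip_mat k = mat k k (\<lambda>(i, j). if i + j + 1 = k then 1 else 0)"

text \<open>A block \<open>(k, \<epsilon>)\<close> stands for a Jordan block \<open>jordan_block k 0\<close> with sign
  characteristic \<open>\<epsilon>\<close>. The next two functions turn a list of blocks into the two matrices of
  the canonical pair. They are applied both to the list of all blocks and to the blocks that
  belong to a single pair of a Segre pairing, in which case the second one yields the
  corresponding diagonal block of \<open>H\<close>.\<close>

definition blocks_jordan :: "(nat \<times> complex) list \<Rightarrow> complex mat" where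
  "blocks_jordan bl = jordan_matrix (map (\<lambda>(k, \<epsilon>). (k, 0)) bl)"

definition blocks_form :: "(nat \<times> complex) list \<Rightarrow> complex mat" where
  "blocks_form bl = diag_block_mat (map (\<lambda>(k, \<epsilon>). \<epsilon> \<cdot>\<^sub>m sip_mat k) bl)"

text \<open>Blocks of size two all have sign \<open>1\<close>: this is forced by nonnegativity.\<close>

definition nonneg_blocks :: "nat \<Rightarrow> nat \<Rightarrow> (nat \<Rightarrow> complex) \<Rightarrow> (nat \<times> complex) list" where
  "nonneg_blocks s t \<epsilon> = map (\<lambda>i. (1, \<epsilon> i)) [0..<s] @ replicate t (2, 1)"


section \<open>Segre pairings\<close>

definition segre_characteristic :: "complex mat \<Rightarrow> nat list \<Rightarrow> bool" where
  "segre_characteristic B ns \<longleftrightarrow> sorted_wrt (\<ge>) ns \<and> jordan_nf B (map (\<lambda>n. (n, 0)) ns)"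

text \<open>The lexicographic arrangement of the pairs only fixes how the collection is written down,
  so a Segre pairing is a multiset. The second conjunct says that every entry of the
  characteristic is used in exactly one pair, counted with multiplicity.\<close>

definition segre_pairing :: "complex mat \<Rightarrow> (nat \<times> nat) multiset \<Rightarrow> bool" where
  "segre_pairing B S \<longleftrightarrow>
     (\<exists>ns. segre_characteristic B ns \<and>
        filter_mset (\<lambda>n. n \<noteq> 0) (image_mset fst S + image_mset snd S) = mset ns \<and>
        (\<forall>(m, n)\<in>#S. m \<in> set ns \<and> n \<in> set ns \<union> {0} \<and> n \<le> m \<and> m - n \<le> 1))"

text \<open>The list \<open>ks\<close> selects, by their positions in \<open>bl\<close>, blocks whose sizes are the (nonzero)
  entries of the pair, in this order.\<close>

fun blocks_of_pair :: "(nat \<times> complex) list \<Rightarrow> nat list \<Rightarrow> nat \<times> nat \<Rightarrow> bool" where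
  "blocks_of_pair bl ks (m, n) \<longleftrightarrow>
     distinct ks \<and> set ks \<subseteq> {..<length bl} \<and>
     map (\<lambda>k. fst (bl ! k)) ks = (if n = 0 then [m] else [m, n])"

text \<open>A distribution of all the blocks over the pairs, each block being used exactly once.\<close>

definition block_assignment ::
  "(nat \<times> complex) list \<Rightarrow> (nat \<times> nat) multiset \<Rightarrow> nat list list \<Rightarrow> bool" where
  "block_assignment bl S kss \<longleftrightarrow>
     (\<exists>ps. mset ps = S \<and> list_all2 (blocks_of_pair bl) kss ps) \<and>
     mset (concat kss) = mset [0..<length bl]"

abbreviation select :: "'a list \<Rightarrow> nat list \<Rightarrow> 'a list" where
  "select bl ks \<equiv> map (\<lambda>k. bl ! k) ks"

text \<open>The zero matrix is not admitted for the pair \<open>(1, 1)\<close>; it belongs to two pairs \<open>(1, 0)\<close>.\<close>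

definition pair_h_roots ::
  "(nat \<times> complex) list \<Rightarrow> nat list \<Rightarrow> nat \<times> nat \<Rightarrow> complex mat set" where
  "pair_h_roots bl ks p =
     {A. sqrt_mat (blocks_jordan (select bl ks)) A \<and>
         \<not> (p = (1, 1) \<and> A = 0\<^sub>m 2 2) \<and>
         h_selfadjoint (blocks_form (select bl ks)) A}"

end

theory Submission
  imports Defs
begin

text \<open>The sizes of the Jordan blocks of a matrix are determined up to order
  (\<open>jordan_nf_unique_mset\<close>), so the nonzero entries of a Segre pairing of \<open>B\<^sub>0\<close> are exactly
  the sizes of the given blocks, each of them \<open>1\<close> or \<open>2\<close>. As the two entries of a pair differ
  by at most one and the first one is positive, only \<open>(2, 2)\<close>, \<open>(2, 1)\<close>, \<open>(1, 1)\<close> and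
  \<open>(1, 0)\<close> can occur. Since the multiset of all nonzero entries is the multiset of all block
  sizes, the blocks themselves can be distributed over the pairs (\<open>ex_block_assignment\<close>).

  Let \<open>J\<close> and \<open>G\<close> be the diagonal blocks of \<open>B\<^sub>0\<close> and \<open>H\<close> for one pair. A square root \<open>A\<close> of
  \<open>J\<close> commutes with \<open>J\<close>, which makes many entries of \<open>A\<close> vanish or coincide. Selfadjointness
  pairs the remaining entries with their complex conjugates, and \<open>A\<^sup>2 = J\<close> then leaves exactly
  the announced parameters (\<open>pair_h_roots_1_1\<close>, \<open>pair_h_roots_2_1\<close>).

  The pair \<open>(2, 2)\<close> has no selfadjoint root (\<open>pair_h_roots_2_2\<close>) because both blocks of size
  two carry the sign \<open>+1\<close>. On the quotient by the kernel of \<open>J\<close> the form \<open>[J x, x]\<close> is positive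
  definite. The operator that \<open>A\<close> induces there is selfadjoint for this form, and its square is
  zero, as the range of \<open>J\<close> lies in the kernel of \<open>J\<close>; hence it vanishes. So \<open>A\<close> maps
  everything into the kernel of \<open>J\<close>, which is isotropic for \<open>G\<close>, and
  \<open>[J x, x] = [A x, A x] = 0\<close> contradicts definiteness. For the pair \<open>(2, 1)\<close> the same identity
  \<open>[J x, x] = [A x, A x]\<close> forces \<open>|\<beta>| = 1\<close>. For \<open>(1, 1)\<close> the condition \<open>|\<beta>| = |\<alpha>|\<close> says that
  the range of \<open>A\<close>, spanned by \<open>(\<alpha>, \<beta>)\<close>, is isotropic.

  The Jordan forms of the roots come from explicit Jordan chains
  (\<open>jordan_nf_trace_free_2\<close>, \<open>jordan_nf_root_3\<close>).\<close>

section \<open>Segre pairings and block sizes\<close>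

text \<open>The number of blocks of a given positive size is an expression in the dimensions of the
  generalized eigenspaces, which depend on the matrix only. Blocks of size zero, which that
  expression does not count, are excluded by \<open>jordan_nf\<close>.\<close>

lemma jordan_nf_unique_mset:
  fixes A :: "'a :: field mat"
  assumes "jordan_nf A xs" and "jordan_nf A ys"
  shows "mset xs = mset ys"
proof (rule multiset_eqI)
  fix p :: "nat \<times> 'a"
  obtain k e where p: "p = (k, e)" by force
  show "count (mset xs) p = count (mset ys) p"
  proof (cases "k = 0")
    case True
    with assms have "p \<notin> set xs" "p \<notin> set ys"
      unfolding jordan_nf_def p by force+
    then show ?thesis by (simp add: count_eq_zero_iff[THEN iffD2])
  next
    case False
    then show ?thesis
      using compute_nr_of_jordan_blocks[OF assms(1), of k e]
        compute_nr_of_jordan_blocks[OF assms(2), of k e]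
      by (simp add: p count_mset count_list_eq_length_filter)
  qed
qed

lemma mset_segre_characteristic:
  assumes "segre_characteristic (blocks_jordan bl) ns" and "0 \<notin> fst ` set bl"
  shows "mset ns = mset (map fst bl)"
proof -
  have "jordan_nf (blocks_jordan bl) (map (\<lambda>(k, \<epsilon>). (k, 0)) bl)"
    using assms(2) unfolding jordan_nf_def blocks_jordan_def
    by (force intro!:
        similar_mat_refl[of _ "sum_list (map fst (map (\<lambda>(k, \<epsilon>). (k, 0 :: complex)) bl))"])
  with assms(1) have "mset (map (\<lambda>n. (n, 0 :: complex)) ns) = mset (map (\<lambda>(k, \<epsilon>). (k, 0)) bl)"
    unfolding segre_characteristic_def by (blast intro: jordan_nf_unique_mset)
  then have "image_mset fst (mset (map (\<lambda>n. (n, 0 :: complex)) ns)) =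
      image_mset fst (mset (map (\<lambda>(k, \<epsilon>). (k, 0 :: complex)) bl))"
    by simp
  then show ?thesis
    by (simp add: image_mset.compositionality comp_def case_prod_beta)
qed

lemma map_eq_concatD:
  assumes "map f xs = concat yss"
  shows "\<exists>xss. concat xss = xs \<and> map (map f) xss = yss"
  using assms
proof (induction yss arbitrary: xs)
  case Nil
  then show ?case by simp
next
  case (Cons ys yss)
  then obtain us vs where uv: "xs = us @ vs" "map f us = ys" "map f vs = concat yss"
    by (auto simp: map_eq_append_conv)
  with Cons.IH obtain vss where "concat vss = vs" "map (map f) vss = yss" by blast
  with uv show ?case by (intro exI[of _ "us # vss"]) simp
qed

text \<open>Read with \<open>f\<close> sending a block to its size, this distributes blocks over slots of prescribed
  sizes: order the blocks so that their sizes form \<open>concat yss\<close>, then cut at the slot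
  boundaries.\<close>

lemma ex_distribution:
  assumes "mset (concat yss) = mset (map f xs)"
  shows "\<exists>xss. mset (concat xss) = mset xs \<and> map (map f) xss = yss"
proof -
  have "list_all2 (\<lambda>y x. f x = y) (map f xs) xs"
    by (simp add: list_all2_conv_all_nth)
  from list_all2_reorder_left_invariance[OF this, of "concat yss"] assms
  obtain zs where zs: "list_all2 (\<lambda>y x. f x = y) (concat yss) zs" "mset zs = mset xs"
    by blast
  then have "map f zs = concat yss"
    by (simp add: list_all2_conv_all_nth list_eq_iff_nth_eq)
  with zs(2) map_eq_concatD show ?thesis by metis
qed

text \<open>The second entry \<open>0\<close> is only a filler that stands for no block.\<close>

definition pair_entries :: "nat \<times> nat \<Rightarrow> nat list" where
  "pair_entries p = (if snd p = 0 then [fst p] else [fst p, snd p])"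

lemma blocks_of_pair_iff:
  "blocks_of_pair bl ks p \<longleftrightarrow>
     distinct ks \<and> set ks \<subseteq> {..<length bl} \<and> map (\<lambda>k. fst (bl ! k)) ks = pair_entries p"
  by (cases p) (simp add: pair_entries_def)

lemma mset_concat_pair_entries:
  assumes "\<forall>p\<in>set ps. fst p \<noteq> 0"
  shows "mset (concat (map pair_entries ps)) =
    filter_mset (\<lambda>n. n \<noteq> 0) (image_mset fst (mset ps) + image_mset snd (mset ps))"
  using assms by (induction ps) (auto simp: pair_entries_def)

lemma ex_block_assignment:
  assumes "segre_pairing (blocks_jordan bl) S" and "0 \<notin> fst ` set bl"
  shows "\<exists>kss. block_assignment bl S kss"
proof -
  obtain ps where ps: "mset ps = S" using ex_mset by blast
  from assms(1) obtain ns where ns: "segre_characteristic (blocks_jordan bl) ns"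
    "filter_mset (\<lambda>n. n \<noteq> 0) (image_mset fst S + image_mset snd S) = mset ns"
    "\<forall>(m, n)\<in>#S. m \<in> set ns \<and> n \<in> set ns \<union> {0} \<and> n \<le> m \<and> m - n \<le> 1"
    unfolding segre_pairing_def by blast
  have mset_ns: "mset ns = mset (map fst bl)"
    by (rule mset_segre_characteristic[OF ns(1) assms(2)])
  then have "set ns = fst ` set bl"
    by (metis list.set_map set_mset_mset)
  with assms(2) ns(3) ps have "\<forall>p\<in>set ps. fst p \<noteq> 0" by fastforce
  from mset_concat_pair_entries[OF this]
  have "mset (concat (map pair_entries ps)) = mset (map fst bl)"
    using ns(2) ps mset_ns by simp
  also have "map fst bl = map (\<lambda>k. fst (bl ! k)) [0..<length bl]"
    by (rule nth_equalityI) auto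
  finally obtain kss where kss: "mset (concat kss) = mset [0..<length bl]"
    "map (map (\<lambda>k. fst (bl ! k))) kss = map pair_entries ps"
    using ex_distribution by blast
  from mset_eq_imp_distinct_iff[OF kss(1)] have "distinct (concat kss)" by simp
  moreover from mset_eq_setD[OF kss(1)] have "set (concat kss) = {..<length bl}" by auto
  ultimately have "distinct ks" "set ks \<subseteq> {..<length bl}" if "ks \<in> set kss" for ks
    using that distinct_concat_iff[of kss] by auto
  then have "list_all2 (blocks_of_pair bl) kss ps"
    using kss(2)
    by (auto simp: list_all2_conv_all_nth blocks_of_pair_iff list_eq_iff_nth_eq[of "map _ _"]
        dest!: map_eq_imp_length_eq)
  with ps kss(1) show ?thesis unfolding block_assignment_def by blast
qed

lemma segre_pairing_entries:
  assumes "segre_pairing (blocks_jordan bl) S" and "fst ` set bl \<subseteq> {1, 2}" and "p \<in># S"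
  shows "p \<in> {(2, 1), (1, 1), (1, 0), (2, 2)}"
proof -
  from assms(1) obtain ns where ns: "segre_characteristic (blocks_jordan bl) ns"
    "\<forall>(m, n)\<in>#S. m \<in> set ns \<and> n \<in> set ns \<union> {0} \<and> n \<le> m \<and> m - n \<le> 1"
    unfolding segre_pairing_def by blast
  have "mset ns = mset (map fst bl)"
    by (rule mset_segre_characteristic[OF ns(1)]) (use assms(2) in auto)
  then have "set ns = fst ` set bl"
    by (metis list.set_map set_mset_mset)
  with ns(2) assms(2,3) show ?thesis
    by (cases p) fastforce
qed

section \<open>Matrices in coordinates\<close>

lemma square_mat_eq_iff:
  assumes "A \<in> carrier_mat n n" and "B \<in> carrier_mat n n"
  shows "A = B \<longleftrightarrow> (\<forall>i<n. \<forall>j<n. A $$ (i, j) = B $$ (i, j))"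
  using assms by auto

lemma index_mult_square:
  assumes "A \<in> carrier_mat n n" and "B \<in> carrier_mat n n" and "i < n" and "j < n"
  shows "(A * B) $$ (i, j) = (\<Sum>k<n. A $$ (i, k) * B $$ (k, j))"
  using assms by (simp add: scalar_prod_def lessThan_atLeast0)

lemma mat_adjoint_carrier:
  "A \<in> carrier_mat n n \<Longrightarrow> mat_adjoint A \<in> carrier_mat n n"
  unfolding mat_adjoint_def by auto

lemma index_mat_adjoint:
  assumes "(A :: complex mat) \<in> carrier_mat n n" and "i < n" and "j < n"
  shows "mat_adjoint A $$ (i, j) = cnj (A $$ (j, i))"
  using assms unfolding mat_adjoint_def by (simp add: mat_of_rows_index)

lemma pair_h_roots_iff:
  assumes "blocks_jordan (select bl ks) = J" and "blocks_form (select bl ks) = G"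
    and "J \<in> carrier_mat n n" and "G \<in> carrier_mat n n"
  shows "A \<in> pair_h_roots bl ks p \<longleftrightarrow>
    A \<in> carrier_mat n n \<and>
    (\<forall>i<n. \<forall>j<n. (\<Sum>k<n. A $$ (i, k) * A $$ (k, j)) = J $$ (i, j)) \<and>
    (\<forall>i<n. \<forall>j<n. (\<Sum>k<n. G $$ (i, k) * A $$ (k, j)) =
      (\<Sum>k<n. cnj (A $$ (k, i)) * G $$ (k, j))) \<and>
    \<not> (p = (1, 1) \<and> A = 0\<^sub>m 2 2)"
proof (cases "A \<in> carrier_mat n n")
  case True
  note A = True mat_adjoint_carrier[OF True]
  have "A * A = J \<longleftrightarrow>
      (\<forall>i<n. \<forall>j<n. (\<Sum>k<n. A $$ (i, k) * A $$ (k, j)) = J $$ (i, j))"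
    using A assms(3)
    by (simp add: square_mat_eq_iff[of _ n] index_mult_square[of _ n] del: index_mult_mat(1))
  moreover have "G * A = mat_adjoint A * G \<longleftrightarrow>
      (\<forall>i<n. \<forall>j<n. (\<Sum>k<n. G $$ (i, k) * A $$ (k, j)) =
        (\<Sum>k<n. cnj (A $$ (k, i)) * G $$ (k, j)))"
    using A assms(4)
    by (simp add: square_mat_eq_iff[of _ n] index_mult_square[of _ n] index_mat_adjoint[of _ n]
        del: index_mult_mat(1))
  ultimately show ?thesis
    using A assms(3) unfolding pair_h_roots_def assms(1,2) sqrt_mat_def h_selfadjoint_def by auto
next
  case False
  then show ?thesis
    using assms(3) unfolding pair_h_roots_def assms(1) sqrt_mat_def by auto
qed

text \<open>The matrices below have size at most four, so bounded quantifiers and sums over indices are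
  written out. The numerals are kept, since the indices then remain in a form in which list
  positions are evaluated directly.\<close>

lemma all_less_numeral:
  fixes P :: "nat \<Rightarrow> bool"
  shows "(\<forall>i<1. P i) \<longleftrightarrow> P 0"
    and "(\<forall>i<2. P i) \<longleftrightarrow> P 0 \<and> P 1"
    and "(\<forall>i<3. P i) \<longleftrightarrow> P 0 \<and> P 1 \<and> P 2"
    and "(\<forall>i<4. P i) \<longleftrightarrow> P 0 \<and> P 1 \<and> P 2 \<and> P 3"
  by (auto simp: numeral_eq_Suc less_Suc_eq)

lemma sum_less_numeral:
  fixes f :: "nat \<Rightarrow> 'a :: comm_monoid_add"
  shows "(\<Sum>k<1. f k) = f 0"
    and "(\<Sum>k<2. f k) = f 0 + f 1"
    and "(\<Sum>k<3. f k) = f 0 + f 1 + f 2"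
    and "(\<Sum>k<4. f k) = f 0 + f 1 + f 2 + f 3"
  by (simp_all add: numeral_eq_Suc)

lemma mat_of_rows_list_carrier_square:
  "length rs = n \<Longrightarrow> mat_of_rows_list n rs \<in> carrier_mat n n"
  unfolding mat_of_rows_list_def by auto

lemma index_mat_of_rows_list:
  "i < length rs \<Longrightarrow> j < n \<Longrightarrow> mat_of_rows_list n rs $$ (i, j) = rs ! i ! j"
  unfolding mat_of_rows_list_def by simp

lemmas expand_entries = all_less_numeral sum_less_numeral index_mat_of_rows_list

lemma square_mat_eqI:
  assumes "A \<in> carrier_mat n n" and "B \<in> carrier_mat n n"
    and "\<forall>i<n. \<forall>j<n. A $$ (i, j) = B $$ (i, j)"
  shows "A = B"
  using assms square_mat_eq_iff by blast

lemma diag_block_mat_pair: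
  "diag_block_mat [A, B] =
    four_block_mat A (0\<^sub>m (dim_row A) (dim_col B)) (0\<^sub>m (dim_row B) (dim_col A)) B"
  by (rule eq_matI) (auto simp: Let_def)

lemma blocks_single:
  "blocks_jordan [(k, a)] = jordan_block k 0"
  "blocks_form [(k, a)] = a \<cdot>\<^sub>m sip_mat k"
  by (auto simp: blocks_jordan_def blocks_form_def jordan_matrix_def sip_mat_def Let_def)

lemma blocks_pair:
  "blocks_jordan [(k, a), (l, b)] =
    four_block_mat (jordan_block k 0) (0\<^sub>m k l) (0\<^sub>m l k) (jordan_block l 0)"
  "blocks_form [(k, a), (l, b)] =
    four_block_mat (a \<cdot>\<^sub>m sip_mat k) (0\<^sub>m k l) (0\<^sub>m l k) (b \<cdot>\<^sub>m sip_mat l)"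
  by (simp_all add: blocks_jordan_def blocks_form_def jordan_matrix_def sip_mat_def
      diag_block_mat_pair del: diag_block_mat.simps)

lemma blocks_1:
  "blocks_jordan [(1, a)] = mat_of_rows_list 1 [[0]]"
  "blocks_form [(1, a)] = mat_of_rows_list 1 [[a]]"
  by (rule square_mat_eqI[of _ 1]; (intro carrier_matI)?; (simp only: all_less_numeral)?;
    simp add: blocks_single sip_mat_def mat_of_rows_list_def)+

lemma blocks_1_1:
  "blocks_jordan [(1, a), (1, b)] = mat_of_rows_list 2 [[0, 0], [0, 0]]"
  "blocks_form [(1, a), (1, b)] = mat_of_rows_list 2 [[a, 0], [0, b]]"
  by (rule square_mat_eqI[of _ 2]; (intro carrier_matI)?; (simp only: all_less_numeral)?;
    simp add: blocks_pair sip_mat_def mat_of_rows_list_def)+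

lemma blocks_2_1:
  "blocks_jordan [(2, a), (1, b)] = mat_of_rows_list 3 [[0, 1, 0], [0, 0, 0], [0, 0, 0]]"
  "blocks_form [(2, a), (1, b)] = mat_of_rows_list 3 [[0, a, 0], [a, 0, 0], [0, 0, b]]"
  by (rule square_mat_eqI[of _ 3]; (intro carrier_matI)?; (simp only: all_less_numeral)?;
    simp add: blocks_pair sip_mat_def mat_of_rows_list_def)+

lemma blocks_2_2:
  "blocks_jordan [(2, a), (2, b)] =
    mat_of_rows_list 4 [[0, 1, 0, 0], [0, 0, 0, 0], [0, 0, 0, 1], [0, 0, 0, 0]]"
  "blocks_form [(2, a), (2, b)] =
    mat_of_rows_list 4 [[0, a, 0, 0], [a, 0, 0, 0], [0, 0, 0, b], [0, 0, b, 0]]"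
  by (rule square_mat_eqI[of _ 4]; (intro carrier_matI)?; (simp only: all_less_numeral)?;
    simp add: blocks_pair sip_mat_def mat_of_rows_list_def)+

lemma mult_mat_of_rows_list_2:
  fixes a00 :: "'a :: comm_semiring_1"
  shows "mat_of_rows_list 2 [[a00, a01], [a10, a11]] *
    mat_of_rows_list 2 [[b00, b01], [b10, b11]] =
    mat_of_rows_list 2
     [[a00 * b00 + a01 * b10,
       a00 * b01 + a01 * b11],
      [a10 * b00 + a11 * b10,
       a10 * b01 + a11 * b11]]"
  by (rule square_mat_eqI[of _ 2])
    (simp_all add: mat_of_rows_list_carrier_square mult_carrier_mat[of _ 2 2 _ 2]
      index_mult_square[of _ 2] expand_entries
      del: index_mult_mat(1) One_nat_def)

lemma one_mat_of_rows_list_2: "1\<^sub>m 2 = mat_of_rows_list 2 [[1, 0], [0, 1]]"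
  by (rule square_mat_eqI[of _ 2])
    (simp_all add: mat_of_rows_list_carrier_square expand_entries del: One_nat_def)

lemma mult_mat_of_rows_list_3:
  fixes a00 :: "'a :: comm_semiring_1"
  shows "mat_of_rows_list 3 [[a00, a01, a02], [a10, a11, a12], [a20, a21, a22]] *
    mat_of_rows_list 3 [[b00, b01, b02], [b10, b11, b12], [b20, b21, b22]] =
    mat_of_rows_list 3
     [[a00 * b00 + a01 * b10 + a02 * b20,
       a00 * b01 + a01 * b11 + a02 * b21,
       a00 * b02 + a01 * b12 + a02 * b22],
      [a10 * b00 + a11 * b10 + a12 * b20,
       a10 * b01 + a11 * b11 + a12 * b21,
       a10 * b02 + a11 * b12 + a12 * b22],
      [a20 * b00 + a21 * b10 + a22 * b20,
       a20 * b01 + a21 * b11 + a22 * b21,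
       a20 * b02 + a21 * b12 + a22 * b22]]"
  by (rule square_mat_eqI[of _ 3])
    (simp_all add: mat_of_rows_list_carrier_square mult_carrier_mat[of _ 3 3 _ 3]
      index_mult_square[of _ 3] expand_entries
      del: index_mult_mat(1) One_nat_def)

lemma one_mat_of_rows_list_3: "1\<^sub>m 3 = mat_of_rows_list 3 [[1, 0, 0], [0, 1, 0], [0, 0, 1]]"
  by (rule square_mat_eqI[of _ 3])
    (simp_all add: mat_of_rows_list_carrier_square expand_entries del: One_nat_def)

section \<open>Selfadjoint square roots for a single pair\<close>

text \<open>The third family of equations, which expresses that a square root of \<open>J\<close> commutes with \<open>J\<close>,
  follows from \<open>J * A = A * A * A = A * J\<close>. It is linear in \<open>A\<close>, unlike the equations for the
  square, and so serves to eliminate entries first.\<close>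

lemma pair_h_rootsD:
  assumes "A \<in> pair_h_roots bl ks p"
    and "blocks_jordan (select bl ks) = J" and "blocks_form (select bl ks) = G"
    and "J \<in> carrier_mat n n" and "G \<in> carrier_mat n n"
    and "i < n" and "j < n"
  shows "(\<Sum>k<n. A $$ (i, k) * A $$ (k, j)) = J $$ (i, j)"
    and "(\<Sum>k<n. G $$ (i, k) * A $$ (k, j)) = (\<Sum>k<n. cnj (A $$ (k, i)) * G $$ (k, j))"
    and "(\<Sum>k<n. J $$ (i, k) * A $$ (k, j)) = (\<Sum>k<n. A $$ (i, k) * J $$ (k, j))"
proof -
  show "(\<Sum>k<n. A $$ (i, k) * A $$ (k, j)) = J $$ (i, j)"
    and "(\<Sum>k<n. G $$ (i, k) * A $$ (k, j)) = (\<Sum>k<n. cnj (A $$ (k, i)) * G $$ (k, j))"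
    using assms(1,6,7) unfolding pair_h_roots_iff[OF assms(2-5)] by blast+
  from assms(1,2,4) have A: "A \<in> carrier_mat n n" and sq: "A * A = J"
    unfolding pair_h_roots_def sqrt_mat_def by auto
  have "J * A = A * J"
    unfolding sq[symmetric] using A by (simp add: assoc_mult_mat[of _ n n _ n _ n])
  then have "(J * A) $$ (i, j) = (A * J) $$ (i, j)" by simp
  then show "(\<Sum>k<n. J $$ (i, k) * A $$ (k, j)) = (\<Sum>k<n. A $$ (i, k) * J $$ (k, j))"
    using A assms(4,6,7) by (simp add: index_mult_square[of _ n] del: index_mult_mat(1))
qed

text \<open>For real \<open>x\<close> the expression \<open>x * x + y * cnj y\<close> is a sum of two squares of absolute values.
  This is where positivity of both signs enters in the case of the pair \<open>(2, 2)\<close>.\<close>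

lemma square_add_cnj_eq_0:
  fixes x y z :: complex
  assumes "x * x + y * z = 0" and "cnj x = x" and "z = cnj y"
  shows "x = 0 \<and> y = 0"
proof -
  have "complex_of_real ((cmod x)\<^sup>2 + (cmod y)\<^sup>2) = x * cnj x + y * cnj y"
    by (simp only: of_real_add complex_norm_square)
  also have "\<dots> = 0" using assms by simp
  finally have "(cmod x)\<^sup>2 + (cmod y)\<^sup>2 = 0"
    by (simp only: of_real_eq_0_iff)
  then show ?thesis by (simp add: sum_power2_eq_zero_iff)
qed

text \<open>The kernel of \<open>J\<close> is spanned by the basis vectors \<open>0\<close> and \<open>2\<close>, so the entries of \<open>A\<close> with row
  and column in \<open>{1, 3}\<close> form the operator that \<open>A\<close> induces on the quotient. It is Hermitian
  because both signs are \<open>1\<close>. The diagonal entry of its square being zero kills the first row,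
  and then the entry \<open>(0, 1)\<close> of \<open>A\<^sup>2\<close>, which should be \<open>1\<close>, vanishes.\<close>

lemma pair_h_roots_2_2:
  assumes "select bl ks = [(2, 1), (2, 1)]"
  shows "pair_h_roots bl ks p = {}"
proof (rule ccontr)
  assume "pair_h_roots bl ks p \<noteq> {}"
  then obtain A where A: "A \<in> pair_h_roots bl ks p" by blast
  let ?J = "mat_of_rows_list 4 [[0, 1, 0, 0], [0, 0, 0, 0], [0, 0, 0, 1], [0, 0, 0, 0]] :: complex mat"
  let ?G = "mat_of_rows_list 4 [[0, 1, 0, 0], [1, 0, 0, 0], [0, 0, 0, 1], [0, 0, 1, 0]] :: complex mat"
  have J: "blocks_jordan (select bl ks) = ?J" "?J \<in> carrier_mat 4 4"
    and G: "blocks_form (select bl ks) = ?G" "?G \<in> carrier_mat 4 4"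
    unfolding assms by (simp_all add: blocks_2_2 mat_of_rows_list_carrier_square)
  define a where "a i j = A $$ (i, j)" for i j
  note D = pair_h_rootsD[OF A J(1) G(1) J(2) G(2)]
  have z: "a 1 0 = 0" "a 1 2 = 0" "a 3 2 = 0"
    using D(3)[of 0 0] D(3)[of 0 2] D(3)[of 2 2]
    by (simp_all add: a_def expand_entries del: One_nat_def)
  have t: "a 1 1 = a 0 0" "a 1 3 = a 0 2" "a 3 1 = a 2 0"
    using D(3)[of 0 1] D(3)[of 0 3] D(3)[of 2 1]
    by (simp_all add: a_def expand_entries del: One_nat_def)
  \<comment> \<open>The form \<open>G\<close> interchanges the indices \<open>0, 1\<close> and the indices \<open>2, 3\<close>, so conjugation
    relates the block on the kernel to the block on the quotient, which agree by \<open>t\<close>.\<close>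
  have h: "a 1 1 = cnj (a 0 0)" "a 1 3 = cnj (a 2 0)"
    using D(2)[of 0 1] D(2)[of 0 3] by (simp_all add: a_def expand_entries del: One_nat_def)
  have s: "a 1 0 * a 0 1 + a 1 1 * a 1 1 + a 1 2 * a 2 1 + a 1 3 * a 3 1 = 0"
    "a 0 0 * a 0 1 + a 0 1 * a 1 1 + a 0 2 * a 2 1 + a 0 3 * a 3 1 = 1"
    using D(1)[of 1 1] D(1)[of 0 1] by (simp_all add: a_def expand_entries del: One_nat_def)
  have "a 1 1 = 0 \<and> a 1 3 = 0"
  proof (rule square_add_cnj_eq_0)
    show "a 1 1 * a 1 1 + a 1 3 * a 3 1 = 0" using s(1) z by simp
    show "cnj (a 1 1) = a 1 1" using h(1) t(1) by (metis complex_cnj_cnj)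
    show "a 3 1 = cnj (a 1 3)" using h(2) t(3) by simp
  qed
  with t h(2) have "a 0 0 = 0" "a 1 1 = 0" "a 0 2 = 0" "a 3 1 = 0" by simp_all
  with s(2) show False by simp
qed

lemma pair_h_roots_1_0:
  assumes "select bl ks = [(1, e)]"
  shows "pair_h_roots bl ks (1, 0) = {mat_of_rows_list 1 [[0]]}"
proof -
  let ?J = "mat_of_rows_list 1 [[0]] :: complex mat"
  let ?G = "mat_of_rows_list 1 [[e]] :: complex mat"
  have J: "blocks_jordan (select bl ks) = ?J" and G: "blocks_form (select bl ks) = ?G"
    and c: "?J \<in> carrier_mat 1 1" "?G \<in> carrier_mat 1 1"
    unfolding assms by (simp_all add: blocks_1 mat_of_rows_list_carrier_square del: One_nat_def)
  show ?thesis
  proof (rule Set.set_eqI)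
    fix A
    show "A \<in> pair_h_roots bl ks (1, 0) \<longleftrightarrow> A \<in> {?J}"
      using c by (auto simp: pair_h_roots_iff[OF J G c] square_mat_eq_iff[of A 1] expand_entries
          simp del: One_nat_def)
  qed
qed

lemma jordan_nf_zero_1: "jordan_nf (mat_of_rows_list 1 [[0]] :: complex mat) [(1, 0)]"
proof -
  \<comment> \<open>The sign of a block has no influence on its Jordan block, so its value is arbitrary here.\<close>
  have "mat_of_rows_list 1 [[0]] = (jordan_matrix [(1, 0)] :: complex mat)"
    unfolding blocks_1(1)[symmetric, of undefined] blocks_jordan_def by simp
  then show ?thesis
    unfolding jordan_nf_def by (auto intro!: similar_mat_refl[of _ 1])
qed

lemma cmod_eq_plus_minus_iff:
  "cmod \<beta> = \<alpha> \<or> cmod \<beta> = - \<alpha> \<longleftrightarrow>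
    \<beta> * cnj \<beta> = complex_of_real \<alpha> * complex_of_real \<alpha>"
proof -
  have "cmod \<beta> = \<alpha> \<or> cmod \<beta> = - \<alpha> \<longleftrightarrow> (cmod \<beta>)\<^sup>2 = \<alpha>\<^sup>2"
    by (simp add: power2_eq_iff)
  also have "\<dots> \<longleftrightarrow> complex_of_real ((cmod \<beta>)\<^sup>2) = complex_of_real (\<alpha>\<^sup>2)"
    by (simp only: of_real_eq_iff)
  also have "complex_of_real ((cmod \<beta>)\<^sup>2) = \<beta> * cnj \<beta>"
    by (simp only: complex_norm_square)
  also have "complex_of_real (\<alpha>\<^sup>2) = complex_of_real \<alpha> * complex_of_real \<alpha>"
    by (simp add: power2_eq_square)
  finally show ?thesis .
qed

text \<open>With opposite signs the off-diagonal entries of a selfadjoint matrix are skew-conjugate and the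
  diagonal is real. If \<open>A\<^sup>2 = 0\<close> and \<open>A\<close> is not zero, the lower left entry cannot vanish, because
  then all entries would; so the trace is zero, and the first diagonal entry of \<open>A\<^sup>2\<close> gives
  \<open>\<alpha>\<^sup>2 = |\<beta>|\<^sup>2\<close>.\<close>

lemma pair_h_roots_1_1:
  assumes "select bl ks = [(1, e), (1, - e)]" and "e \<in> {1, -1}"
  shows "pair_h_roots bl ks (1, 1) =
    {mat_of_rows_list 2 [[complex_of_real \<alpha>, - cnj \<beta>], [\<beta>, - complex_of_real \<alpha>]] | \<alpha> \<beta>.
       \<alpha> \<noteq> 0 \<and> (cmod \<beta> = \<alpha> \<or> cmod \<beta> = - \<alpha>)}"
    (is "?L = ?R")
proof -
  let ?J = "mat_of_rows_list 2 [[0, 0], [0, 0]] :: complex mat"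
  let ?G = "mat_of_rows_list 2 [[e, 0], [0, - e]] :: complex mat"
  have J: "blocks_jordan (select bl ks) = ?J" and G: "blocks_form (select bl ks) = ?G"
    and c: "?J \<in> carrier_mat 2 2" "?G \<in> carrier_mat 2 2"
    unfolding assms by (simp_all add: blocks_1_1 mat_of_rows_list_carrier_square del: One_nat_def)
  note iff = pair_h_roots_iff[OF J G c]
  show ?thesis
  proof (intro equalityI subsetI)
    fix A
    assume "A \<in> ?L"
    note A = \<open>A \<in> ?L\<close>[unfolded iff]
    define a where "a i j = A $$ (i, j)" for i j
    have carrier: "A \<in> carrier_mat 2 2" and "A \<noteq> 0\<^sub>m 2 2" using A by auto
    then have nz: "\<not> (a 0 0 = 0 \<and> a 0 1 = 0 \<and> a 1 0 = 0 \<and> a 1 1 = 0)"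
      by (auto simp: a_def square_mat_eq_iff[of _ 2] expand_entries)
    note D = pair_h_rootsD[OF \<open>A \<in> ?L\<close> J G c]
    have sq: "a 0 0 * a 0 0 + a 0 1 * a 1 0 = 0" "a 0 0 * a 0 1 + a 0 1 * a 1 1 = 0"
      "a 1 0 * a 0 1 + a 1 1 * a 1 1 = 0"
      using D(1)[of 0 0] D(1)[of 0 1] D(1)[of 1 1]
      by (simp_all add: a_def expand_entries del: One_nat_def)
    have "e * a 0 0 = e * cnj (a 0 0)" "e * a 0 1 = e * (- cnj (a 1 0))"
      using D(2)[of 0 0] D(2)[of 0 1]
      by (simp_all add: a_def expand_entries mult.commute del: One_nat_def)
    moreover have "e \<noteq> 0" using assms(2) by auto
    ultimately have real: "cnj (a 0 0) = a 0 0" and skew: "a 0 1 = - cnj (a 1 0)"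
      by (metis mult_left_cancel)+
    have "a 1 0 \<noteq> 0"
    proof
      assume "a 1 0 = 0"
      moreover from this skew have "a 0 1 = 0" by simp
      ultimately show False using nz sq by simp
    qed
    have "a 0 1 * (a 0 0 + a 1 1) = 0" using sq(2) by (simp add: algebra_simps)
    with \<open>a 1 0 \<noteq> 0\<close> skew have "a 0 0 + a 1 1 = 0" by simp
    then have tr: "a 1 1 = - a 0 0" by (metis add_eq_0_iff)
    obtain \<alpha> where \<alpha>: "a 0 0 = complex_of_real \<alpha>"
      using real by (metis Reals_cnj_iff Reals_cases)
    have "cmod (a 1 0) = \<alpha> \<or> cmod (a 1 0) = - \<alpha>"
      unfolding cmod_eq_plus_minus_iff using sq(1) skew \<alpha> by (simp add: mult.commute)
    moreover from this have "\<alpha> \<noteq> 0" using \<open>a 1 0 \<noteq> 0\<close> by auto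
    moreover have "A = mat_of_rows_list 2 [[complex_of_real \<alpha>, - cnj (a 1 0)],
        [a 1 0, - complex_of_real \<alpha>]]"
      by (rule square_mat_eqI[OF carrier])
        (use \<alpha> tr skew in \<open>simp_all add: a_def expand_entries
          mat_of_rows_list_carrier_square del: One_nat_def\<close>)
    ultimately show "A \<in> ?R" by blast
  next
    fix A
    assume "A \<in> ?R"
    then obtain \<alpha> \<beta> where A: "A = mat_of_rows_list 2 [[complex_of_real \<alpha>, - cnj \<beta>],
        [\<beta>, - complex_of_real \<alpha>]]"
      and \<alpha>: "\<alpha> \<noteq> 0" "cmod \<beta> = \<alpha> \<or> cmod \<beta> = - \<alpha>" by blast
    from \<alpha>(2) have "\<beta> * cnj \<beta> = complex_of_real \<alpha> * complex_of_real \<alpha>"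
      by (simp only: cmod_eq_plus_minus_iff)
    moreover have "A \<noteq> 0\<^sub>m 2 2"
    proof
      assume "A = 0\<^sub>m 2 2"
      then have "A $$ (0, 0) = 0" by simp
      then show False using \<alpha>(1) by (simp add: A mat_of_rows_list_def)
    qed
    ultimately show "A \<in> ?L"
      unfolding iff using assms(2)
      by (auto simp: A expand_entries mat_of_rows_list_carrier_square mult.commute)
  qed
qed

text \<open>The Jordan chain is \<open>A e, e\<close> with \<open>e\<close> the basis vector \<open>0\<close>: its image \<open>(\<alpha>, \<beta>)\<close> is
  independent of \<open>e\<close> as \<open>\<beta>\<close> is not zero, and \<open>A\<^sup>2 = 0\<close>.\<close>

lemma jordan_nf_trace_free_2:
  fixes \<alpha> \<beta> :: complex
  assumes "\<beta> \<noteq> 0" and "\<gamma> * \<beta> = - (\<alpha> * \<alpha>)"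
  shows "jordan_nf (mat_of_rows_list 2 [[\<alpha>, \<gamma>], [\<beta>, - \<alpha>]]) [(2, 0)]"
proof -
  let ?A = "mat_of_rows_list 2 [[\<alpha>, \<gamma>], [\<beta>, - \<alpha>]]"
  \<comment> \<open>The columns of \<open>?P\<close> are the Jordan chain, and \<open>?Q\<close> is the inverse of \<open>?P\<close>.\<close>
  let ?P = "mat_of_rows_list 2 [[\<alpha>, 1], [\<beta>, 0]]"
  let ?Q = "mat_of_rows_list 2 [[0, 1 / \<beta>], [1, - \<alpha> / \<beta>]]"
  have g: "\<gamma> = - (\<alpha> * \<alpha>) / \<beta>" using assms by (simp add: field_simps)
  have J: "jordan_matrix [(2, 0)] =
      (mat_of_rows_list 2 [[0, 1], [0, 0]] :: complex mat)"
    by (rule square_mat_eqI[of _ 2]; (intro carrier_matI)?; (simp only: all_less_numeral)?)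
      (simp_all add: jordan_matrix_def mat_of_rows_list_def)
  have "similar_mat ?A (jordan_matrix [(2, 0)])" unfolding J
  proof (rule similar_matI[of _ _ ?P ?Q 2])
  qed (use assms in \<open>simp_all add: g mat_of_rows_list_carrier_square mult_mat_of_rows_list_2
    one_mat_of_rows_list_2 field_simps\<close>)
  then show ?thesis unfolding jordan_nf_def by simp
qed

text \<open>Commuting with \<open>J\<close> makes \<open>A\<close> map the kernel of \<open>J\<close>, spanned by the basis vectors \<open>0\<close> and \<open>2\<close>,
  into the range of \<open>J\<close>, up to the diagonal; the diagonal vanishes since \<open>A\<close> is nilpotent. What
  remains of \<open>A\<^sup>2 = J\<close> is that the entries \<open>(0, 2)\<close> and \<open>(2, 1)\<close> have product \<open>1\<close>. As they are
  conjugate by selfadjointness, their absolute value is \<open>1\<close>.\<close>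

lemma pair_h_roots_2_1:
  assumes "select bl ks = [(2, 1), (1, 1)]"
  shows "pair_h_roots bl ks (2, 1) =
    {mat_of_rows_list 3 [[0, complex_of_real \<alpha>, \<beta>], [0, 0, 0], [0, 1 / \<beta>, 0]] | \<alpha> \<beta>.
       cmod \<beta> = 1}"
    (is "?L = ?R")
proof -
  let ?J = "mat_of_rows_list 3 [[0, 1, 0], [0, 0, 0], [0, 0, 0]] :: complex mat"
  let ?G = "mat_of_rows_list 3 [[0, 1, 0], [1, 0, 0], [0, 0, 1]] :: complex mat"
  have J: "blocks_jordan (select bl ks) = ?J" and G: "blocks_form (select bl ks) = ?G"
    and c: "?J \<in> carrier_mat 3 3" "?G \<in> carrier_mat 3 3"
    unfolding assms by (simp_all add: blocks_2_1 mat_of_rows_list_carrier_square del: One_nat_def)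
  note iff = pair_h_roots_iff[OF J G c]
  show ?thesis
  proof (intro equalityI subsetI)
    fix A
    assume "A \<in> ?L"
    note D = pair_h_rootsD[OF \<open>A \<in> ?L\<close> J G c]
    define a where "a i j = A $$ (i, j)" for i j
    have carrier: "A \<in> carrier_mat 3 3" using \<open>A \<in> ?L\<close> iff by blast
    have z: "a 1 0 = 0" "a 1 2 = 0" "a 2 0 = 0" "a 1 1 = a 0 0"
      using D(3)[of 0 0] D(3)[of 0 2] D(3)[of 2 1] D(3)[of 0 1]
      by (simp_all add: a_def expand_entries del: One_nat_def)
    have sq: "a 1 0 * a 0 1 + a 1 1 * a 1 1 + a 1 2 * a 2 1 = 0"
      "a 2 0 * a 0 2 + a 2 1 * a 1 2 + a 2 2 * a 2 2 = 0"
      "a 0 0 * a 0 1 + a 0 1 * a 1 1 + a 0 2 * a 2 1 = 1"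
      using D(1)[of 1 1] D(1)[of 2 2] D(1)[of 0 1]
      by (simp_all add: a_def expand_entries del: One_nat_def)
    have d: "a 0 0 = 0" "a 1 1 = 0" "a 2 2 = 0" using sq(1,2) z by simp_all
    have real: "cnj (a 0 1) = a 0 1"
      using D(2)[of 1 1] by (simp add: a_def expand_entries del: One_nat_def)
    have "a 0 2 = cnj (a 2 1)"
      using D(2)[of 1 2] by (simp add: a_def expand_entries del: One_nat_def)
    then have adj: "a 2 1 = cnj (a 0 2)" by simp
    obtain \<alpha> where \<alpha>: "a 0 1 = complex_of_real \<alpha>"
      using real by (metis Reals_cnj_iff Reals_cases)
    have prod: "a 0 2 * cnj (a 0 2) = 1" using sq(3) d adj by simp
    then have "complex_of_real ((cmod (a 0 2))\<^sup>2) = complex_of_real 1"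
      by (simp only: complex_norm_square of_real_1)
    then have "(cmod (a 0 2))\<^sup>2 = 1" by (simp only: of_real_eq_iff)
    then have "cmod (a 0 2) = 1"
      by (metis norm_ge_zero power2_eq_1_iff neg_0_le_iff_le not_one_le_zero)
    moreover have "a 2 1 = 1 / a 0 2"
      using prod adj by (metis mult_zero_left nonzero_eq_divide_eq mult.commute zero_neq_one)
    then have "A = mat_of_rows_list 3 [[0, complex_of_real \<alpha>, a 0 2], [0, 0, 0], [0, 1 / a 0 2, 0]]"
      by (intro square_mat_eqI[OF carrier])
        (use \<alpha> z d in \<open>simp_all add: a_def expand_entries
          mat_of_rows_list_carrier_square del: One_nat_def\<close>)
    ultimately show "A \<in> ?R" by blast
  next
    fix A
    assume "A \<in> ?R"
    then obtain \<alpha> \<beta> where A: "A = mat_of_rows_list 3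
        [[0, complex_of_real \<alpha>, \<beta>], [0, 0, 0], [0, 1 / \<beta>, 0]]"
      and \<beta>: "cmod \<beta> = 1" by blast
    have "\<beta> * cnj \<beta> = 1" using \<beta> by (simp flip: complex_norm_square)
    moreover from this have "\<beta> \<noteq> 0" by auto
    ultimately have "cnj \<beta> = 1 / \<beta>" by (simp add: field_simps)
    with \<open>\<beta> \<noteq> 0\<close> show "A \<in> ?L"
      unfolding iff by (auto simp: A expand_entries mat_of_rows_list_carrier_square)
  qed
qed

text \<open>The Jordan chain is \<open>A\<^sup>2 e, A e, e\<close> with \<open>e\<close> the basis vector \<open>1\<close>, for which
  \<open>A e = (\<alpha>, 0, 1 / \<beta>)\<close> and \<open>A\<^sup>2 e\<close> is the basis vector \<open>0\<close>.\<close>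

lemma jordan_nf_root_3:
  fixes \<alpha> \<beta> :: complex
  assumes "\<beta> \<noteq> 0"
  shows "jordan_nf (mat_of_rows_list 3 [[0, \<alpha>, \<beta>], [0, 0, 0], [0, 1 / \<beta>, 0]]) [(3, 0)]"
proof -
  let ?A = "mat_of_rows_list 3 [[0, \<alpha>, \<beta>], [0, 0, 0], [0, 1 / \<beta>, 0]]"
  \<comment> \<open>The columns of \<open>?P\<close> are the Jordan chain, and \<open>?Q\<close> is the inverse of \<open>?P\<close>.\<close>
  let ?P = "mat_of_rows_list 3 [[1, \<alpha>, 0], [0, 0, 1], [0, 1 / \<beta>, 0]]"
  let ?Q = "mat_of_rows_list 3 [[1, 0, - \<alpha> * \<beta>], [0, 0, \<beta>], [0, 1, 0]]"
  have J: "jordan_matrix [(3, 0)] =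
      (mat_of_rows_list 3 [[0, 1, 0], [0, 0, 1], [0, 0, 0]] :: complex mat)"
    by (rule square_mat_eqI[of _ 3]; (intro carrier_matI)?; (simp only: all_less_numeral)?)
      (simp_all add: jordan_matrix_def mat_of_rows_list_def)
  have "similar_mat ?A (jordan_matrix [(3, 0)])" unfolding J
  proof (rule similar_matI[of _ _ ?P ?Q 3])
  qed (use assms in \<open>simp_all add: mat_of_rows_list_carrier_square mult_mat_of_rows_list_3
    one_mat_of_rows_list_3 field_simps\<close>)
  then show ?thesis unfolding jordan_nf_def by simp
qed

section \<open>Nonnegative canonical pairs\<close>

lemma nonneg_blocksD:
  assumes "(k, e) \<in> set (nonneg_blocks s t \<epsilon>)" and "\<And>i. i < s \<Longrightarrow> \<epsilon> i \<in> {1, -1}"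
  shows "k = 1 \<and> e \<in> {1, -1} \<or> k = 2 \<and> e = 1"
  using assms unfolding nonneg_blocks_def by force

theorem theorem4p3:
  fixes H B\<^sub>0 :: "complex mat" and n s t :: nat and \<epsilon> :: "nat \<Rightarrow> complex"
    and bl :: "(nat \<times> complex) list" and S :: "(nat \<times> nat) multiset"
  assumes "H \<in> carrier_mat n n" and "invertible_mat H" and "hermitian_mat H"
    and "B\<^sub>0 \<in> carrier_mat n n" and "nilpotent_mat B\<^sub>0" and "h_nonnegative H B\<^sub>0"
    and "\<And>i. i < s \<Longrightarrow> \<epsilon> i \<in> {1, -1}"
    and "bl = nonneg_blocks s t \<epsilon>"
    and "B\<^sub>0 = blocks_jordan bl" and "H = blocks_form bl"
    and "t \<le> card {i. i < s \<and> \<epsilon> i = 1}"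
    and "segre_pairing B\<^sub>0 S"
  shows
    \<comment> \<open>the possible pairs\<close>
    "(\<forall>p\<in>#S. p \<in> {(2, 1), (1, 1), (1, 0)} \<or>
        (p = (2, 2) \<and> (\<forall>ks. blocks_of_pair bl ks p \<longrightarrow> pair_h_roots bl ks p = {}))) \<and>
    \<comment> \<open>the corresponding Jordan blocks\<close>
    (\<exists>kss. block_assignment bl S kss) \<and>
    (\<forall>ks. (2, 1) \<in># S \<and> blocks_of_pair bl ks (2, 1) \<longrightarrow>
        blocks_jordan (select bl ks) = diag_block_mat [jordan_block 2 0, jordan_block 1 0]) \<and>
    (\<forall>ks. (1, 1) \<in># S \<and> blocks_of_pair bl ks (1, 1) \<longrightarrow>
        blocks_jordan (select bl ks) = diag_block_mat [jordan_block 1 0, jordan_block 1 0]) \<and>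
    (\<forall>ks. (1, 0) \<in># S \<and> blocks_of_pair bl ks (1, 0) \<longrightarrow>
        blocks_jordan (select bl ks) = jordan_block 1 0) \<and>
    \<comment> \<open>(i)\<close>
    (\<forall>k. (1, 0) \<in># S \<and> blocks_of_pair bl [k] (1, 0) \<longrightarrow>
        pair_h_roots bl [k] (1, 0) = {mat_of_rows_list 1 [[0]]} \<and>
        (\<forall>A\<in>pair_h_roots bl [k] (1, 0). jordan_nf A [(1, 0)])) \<and>
    \<comment> \<open>(ii)\<close>
    (\<forall>k l. (1, 1) \<in># S \<and> blocks_of_pair bl [k, l] (1, 1) \<and>
          snd (bl ! k) = - snd (bl ! l) \<longrightarrow>
        pair_h_roots bl [k, l] (1, 1) =
          {mat_of_rows_list 2 [[complex_of_real \<alpha>, - cnj \<beta>],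
                               [\<beta>, - complex_of_real \<alpha>]] | \<alpha> \<beta>.
             \<alpha> \<noteq> 0 \<and> (cmod \<beta> = \<alpha> \<or> cmod \<beta> = - \<alpha>)} \<and>
        (\<forall>A\<in>pair_h_roots bl [k, l] (1, 1). jordan_nf A [(2, 0)])) \<and>
    \<comment> \<open>(iii)\<close>
    (\<forall>k l. (2, 1) \<in># S \<and> blocks_of_pair bl [k, l] (2, 1) \<and>
          snd (bl ! k) = 1 \<and> snd (bl ! l) = 1 \<longrightarrow>
        pair_h_roots bl [k, l] (2, 1) =
          {mat_of_rows_list 3 [[0, complex_of_real \<alpha>, \<beta>],
                               [0, 0, 0],
                               [0, 1 / \<beta>, 0]] | \<alpha> \<beta>. cmod \<beta> = 1} \<and>
        (\<forall>A\<in>pair_h_roots bl [k, l] (2, 1). jordan_nf A [(3, 0)]))"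
  proof -
  note blocks = nonneg_blocksD[of _ _ s t \<epsilon>, folded assms(8), OF _ assms(7)]
  have sizes: "fst ` set bl \<subseteq> {1, 2}" "0 \<notin> fst ` set bl"
    using blocks by fastforce+
  have entry: "fst (bl ! k) = 1 \<and> snd (bl ! k) \<in> {1, -1} \<or> bl ! k = (2, 1)"
    if "k < length bl" for k
  proof -
    have "(fst (bl ! k), snd (bl ! k)) \<in> set bl" using that by simp
    from blocks[OF this] show ?thesis by (auto simp: prod_eq_iff)
  qed
  have sign_1: "snd (bl ! k) \<in> {1, -1}" if "k < length bl" "fst (bl ! k) = 1" for k
    using entry[OF that(1)] that(2) by auto
  have size_2: "bl ! k = (2, 1)" if "k < length bl" "fst (bl ! k) = 2" for k
    using entry[OF that(1)] that(2) by auto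
  have segre: "segre_pairing (blocks_jordan bl) S"
    using assms(9,12) by simp
  have pairs: "p \<in> {(2, 1), (1, 1), (1, 0)} \<or>
      (p = (2, 2) \<and> (\<forall>ks. blocks_of_pair bl ks p \<longrightarrow> pair_h_roots bl ks p = {}))"
    if "p \<in># S" for p
  proof -
    have "pair_h_roots bl ks (2, 2) = {}" if "blocks_of_pair bl ks (2, 2)" for ks
    proof (rule pair_h_roots_2_2)
      from that obtain k l where "ks = [k, l]" by (auto simp: map_eq_Cons_conv)
      with that size_2 show "select bl ks = [(2, 1), (2, 1)]" by auto
    qed
    with segre_pairing_entries[OF segre sizes(1) that] show ?thesis by blast
  qed
  have jordan: "blocks_jordan (select bl ks) =
      diag_block_mat (map (\<lambda>n. jordan_block n 0) (pair_entries p))"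
    if "blocks_of_pair bl ks p" for ks p
  proof -
    have "pair_entries p = map (\<lambda>k. fst (bl ! k)) ks"
      using that by (simp only: blocks_of_pair_iff)
    then show ?thesis
      by (simp add: blocks_jordan_def jordan_matrix_def case_prod_beta comp_def)
  qed
  have one_zero: "pair_h_roots bl [k] (1, 0) = {mat_of_rows_list 1 [[0]]} \<and>
      (\<forall>A\<in>pair_h_roots bl [k] (1, 0). jordan_nf A [(1, 0)])"
    if "blocks_of_pair bl [k] (1, 0)" for k
  proof -
    have "select bl [k] = [(1, snd (bl ! k))]" using that by (simp add: prod_eq_iff)
    from pair_h_roots_1_0[OF this] jordan_nf_zero_1 show ?thesis by auto
  qed
  have one_one: "pair_h_roots bl [k, l] (1, 1) =
        {mat_of_rows_list 2 [[complex_of_real \<alpha>, - cnj \<beta>],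
                             [\<beta>, - complex_of_real \<alpha>]] | \<alpha> \<beta>.
           \<alpha> \<noteq> 0 \<and> (cmod \<beta> = \<alpha> \<or> cmod \<beta> = - \<alpha>)} \<and>
      (\<forall>A\<in>pair_h_roots bl [k, l] (1, 1). jordan_nf A [(2, 0)])"
    if "blocks_of_pair bl [k, l] (1, 1)" "snd (bl ! k) = - snd (bl ! l)" for k l
  proof -
    have e: "snd (bl ! k) \<in> {1, -1}"
      and sel: "select bl [k, l] = [(1, snd (bl ! k)), (1, - snd (bl ! k))]"
      using that sign_1[of k] by (simp_all add: prod_eq_iff)
    have "jordan_nf (mat_of_rows_list 2 [[complex_of_real \<alpha>, - cnj \<beta>],
        [\<beta>, - complex_of_real \<alpha>]]) [(2, 0)]"
      if "\<alpha> \<noteq> 0" "cmod \<beta> = \<alpha> \<or> cmod \<beta> = - \<alpha>" for \<alpha> \<beta>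
    proof (rule jordan_nf_trace_free_2)
      show "\<beta> \<noteq> 0" using that by auto
      from that(2) have "\<beta> * cnj \<beta> = complex_of_real \<alpha> * complex_of_real \<alpha>"
        by (simp only: cmod_eq_plus_minus_iff)
      then show "- cnj \<beta> * \<beta> = - (complex_of_real \<alpha> * complex_of_real \<alpha>)"
        by (simp add: mult.commute)
    qed
    with pair_h_roots_1_1[OF sel e] show ?thesis by auto
  qed
  have two_one: "pair_h_roots bl [k, l] (2, 1) =
        {mat_of_rows_list 3 [[0, complex_of_real \<alpha>, \<beta>],
                             [0, 0, 0],
                             [0, 1 / \<beta>, 0]] | \<alpha> \<beta>. cmod \<beta> = 1} \<and>
      (\<forall>A\<in>pair_h_roots bl [k, l] (2, 1). jordan_nf A [(3, 0)])"
    if "blocks_of_pair bl [k, l] (2, 1)" "snd (bl ! k) = 1" "snd (bl ! l) = 1" for k l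
  proof -
    have sel: "select bl [k, l] = [(2, 1), (1, 1)]"
      using that by (simp add: prod_eq_iff)
    have "jordan_nf (mat_of_rows_list 3 [[0, complex_of_real \<alpha>, \<beta>], [0, 0, 0], [0, 1 / \<beta>, 0]])
        [(3, 0)]" if "cmod \<beta> = 1" for \<alpha> \<beta>
      by (rule jordan_nf_root_3) (use that in auto)
    with pair_h_roots_2_1[OF sel] show ?thesis by auto
  qed
  have jordan_2_1: "blocks_jordan (select bl ks) =
      diag_block_mat [jordan_block 2 0, jordan_block 1 0]"
    if "blocks_of_pair bl ks (2, 1)" for ks
    using jordan[OF that] by (simp add: pair_entries_def del: diag_block_mat.simps)
  have jordan_1_1: "blocks_jordan (select bl ks) =
      diag_block_mat [jordan_block 1 0, jordan_block 1 0]"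
    if "blocks_of_pair bl ks (1, 1)" for ks
    using jordan[OF that] by (simp add: pair_entries_def del: diag_block_mat.simps)
  have jordan_1_0: "blocks_jordan (select bl ks) = jordan_block 1 0"
    if "blocks_of_pair bl ks (1, 0)" for ks
    using jordan[OF that] by (simp add: pair_entries_def del: diag_block_mat.simps)
  show ?thesis
    by (intro conjI; (intro ballI allI impI)?; (elim conjE)?;
        rule pairs ex_block_assignment[OF segre sizes(2)] jordan_2_1 jordan_1_1 jordan_1_0
          one_zero one_one two_one; assumption)
qed

end
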